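(* Let $T[1,n]$ be a string, $\epsilon>0$, and let $\mathcal{G}(T)$ be the weighted DAG with vertices $v_1,\dots,v_{n+1}$ and an edge $(v_i,v_j)$ for each $1\le i<j\le n+1$ of cost $c(v_i,v_j)=|\mathcal{C}(T[i,j-1])|$, the length in bits of the compression of $T[i,j-1]$ by the base compressor $\mathcal{C}$, which is assumed to satisfy the monotonicity assumption in the context. Let $\mathcal{G}_\epsilon(T)$ be the subgraph of $\mathcal{G}(T)$ on the same vertices containing exactly those edges $(v_i,v_j)$, $i<j$, such that either (a) there is a positive integer $k$ with $c(v_i,v_j)\le(1+\epsilon)^k<c(v_i,v_{j+1})$, or (b) $j=n+1$. Then the shortest path in $\mathcal{G}_\epsilon(T)$ from $v_1$ to $v_{n+1}$ has total cost at most $(1+\epsilon)\,d_{\mathcal{G}(T)}(v_1,v_{n+1})$, where $d_{\mathcal{G}(T)}$ is the shortest-path distance in $\mathcal{G}(T)$.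
   Context: $\mathcal{C}$ produces prefix-free encodings, so compressed sizes are positive integers (numbers of bits). Paths from $v_1$ to $v_{n+1}$ in $\mathcal{G}(T)$ correspond one-to-one to partitions of $T$ into contiguous substrings (edge $(v_i,v_j)$ corresponds to the part $T[i,j-1]$), and the cost of a path equals the total compressed size of the corresponding partition. The paper assumes monotone costs: $0<c(v_i,v_{i+1})\le c(v_i,v_{i+2})\le\dots\le c(v_i,v_{n+1})$ for every $i$, and more generally the compressed size of a substring of $T$ is at most that of any substring of $T$ containing it. *)

theory Defs
  imports "Graph_Theory.Shortest_Path" "Graph_Theory.Pair_Digraph" "HOL-Library.Sublist"
begin

text \<open>
  Strings are lists over an arbitrary alphabet; a compressor maps strings to bit strings.
  Positions are numbered from 1, so \<open>substring T i j\<close> is $T[i,j]$ with both ends included.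
\<close>

type_synonym 'a compressor = "'a list \<Rightarrow> bool list"

definition substring :: "'a list \<Rightarrow> nat \<Rightarrow> nat \<Rightarrow> 'a list" where
  "substring T i j = drop (i - 1) (take j T)"

text \<open>The empty string is never compressed, so its encoding is not constrained.\<close>

definition prefix_free :: "'a compressor \<Rightarrow> bool" where
  "prefix_free C \<longleftrightarrow> (\<forall>x y. x \<noteq> [] \<and> y \<noteq> [] \<and> x \<noteq> y \<longrightarrow> \<not> prefix (C x) (C y))"

text \<open>The vertex \<open>v\<^sub>i\<close> is represented by \<open>i\<close>, the edge $(v_i,v_j)$ by the pair \<open>(i, j)\<close>.\<close>

definition edge_cost :: "'a compressor \<Rightarrow> 'a list \<Rightarrow> nat \<times> nat \<Rightarrow> nat" where
  "edge_cost C T = (\<lambda>(i, j). length (C (substring T i (j - 1))))"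

definition partition_dag :: "'a list \<Rightarrow> nat pair_pre_digraph" where
  "partition_dag T = \<lparr> pverts = {1..length T + 1},
     parcs = {(i, j). 1 \<le> i \<and> i < j \<and> j \<le> length T + 1} \<rparr>"

text \<open>
  The edge $(v_i,v_{j+1})$ does not exist for $j = n+1$, hence the guard
  \<open>j \<le> length T\<close> in the first alternative.
\<close>

definition pruned_dag :: "'a compressor \<Rightarrow> real \<Rightarrow> 'a list \<Rightarrow> nat pair_pre_digraph" where
  "pruned_dag C \<epsilon> T = \<lparr> pverts = pverts (partition_dag T),
     parcs = {(i, j) \<in> parcs (partition_dag T).
       (j \<le> length T \<and>
         (\<exists>k::nat. k \<ge> 1 \<and> real (edge_cost C T (i, j)) \<le> (1 + \<epsilon>) ^ k \<and>
            (1 + \<epsilon>) ^ k < real (edge_cost C T (i, j + 1)))) \<or>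
       j = length T + 1} \<rparr>"

definition monotone_costs :: "'a compressor \<Rightarrow> 'a list \<Rightarrow> bool" where
  "monotone_costs C T \<longleftrightarrow>
     (\<forall>i\<in>{1..length T}. 0 < edge_cost C T (i, i + 1) \<and>
        (\<forall>j. i < j \<and> j \<le> length T \<longrightarrow> edge_cost C T (i, j) \<le> edge_cost C T (i, j + 1))) \<and>
     (\<forall>u v. u \<noteq> [] \<and> sublist u v \<and> sublist v T \<longrightarrow> length (C u) \<le> length (C v))"

definition shortest_path ::
  "('v, 'e) pre_digraph \<Rightarrow> 'e weight_fun \<Rightarrow> 'v \<Rightarrow> 'e awalk \<Rightarrow> 'v \<Rightarrow> bool" where
  "shortest_path G w u p v \<longleftrightarrow> pre_digraph.apath G u p v \<and>
     (\<forall>q. pre_digraph.apath G u q v \<longrightarrow> wf_digraph.awalk_cost w p \<le> wf_digraph.awalk_cost w q)"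

text \<open>The library notions of walk cost and distance are meaningful for well-formed digraphs.\<close>

lemma wf_partition_dag: "wf_digraph (with_proj (partition_dag T))"
  by unfold_locales (auto simp: partition_dag_def)

lemma wf_pruned_dag: "wf_digraph (with_proj (pruned_dag C \<epsilon> T))"
  by unfold_locales (auto simp: pruned_dag_def partition_dag_def)

end

theory Submission
  imports Defs
begin

text \<open>
  An optimal path of the full DAG is followed greedily in the pruned DAG, never falling behind it.
  If the optimal path takes the edge \<open>(i, j)\<close> while the pruned path stands at \<open>s\<close> with
  \<open>i \<le> s < j\<close>, then \<open>c (s, j) \<le> c (i, j)\<close> by monotonicity. Rounding
  \<open>c (s, j)\<close> up to a power of \<open>1 + \<epsilon>\<close> costs at most a factor
  \<open>1 + \<epsilon>\<close>, and the longest edge from \<open>s\<close> within that power survives the pruning and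
  reaches \<open>j\<close> or beyond. So each edge of the optimal path pays for at most one edge of the
  pruned path.
\<close>

lemma exists_power_within_factor:
  fixes a x :: real
  assumes "a > 1" "x \<ge> 1"
  obtains k :: nat where "k \<ge> 1" "x \<le> a ^ k" "a ^ k \<le> a * x"
proof -
  \<comment> \<open>The exponent used is \<open>Suc k\<close>, hence positive as the pruning rule
    demands. Minimality of \<open>k\<close>, or \<open>x \<ge> 1\<close> when \<open>k = 0\<close>,
    keeps \<open>a ^ k\<close> at most \<open>x\<close>, so rounding up loses at most one factor
    \<open>a\<close>.\<close>
  define k where "k = (LEAST k. x \<le> a ^ Suc k)"
  obtain m where "x < a ^ m"
    using real_arch_pow[OF assms(1)] by blast
  also have "a ^ m \<le> a ^ Suc m"
    using assms(1) by simp
  finally have "x \<le> a ^ Suc m"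
    by simp
  then have le: "x \<le> a ^ Suc k"
    unfolding k_def by (rule LeastI)
  have "a ^ k \<le> x"
  proof (cases k)
    case 0
    then show ?thesis
      using assms(2) by simp
  next
    case (Suc l)
    then have "\<not> x \<le> a ^ Suc l"
      unfolding k_def by (intro not_less_Least) simp
    then show ?thesis
      using Suc by simp
  qed
  then have "a ^ Suc k \<le> a * x"
    using assms(1) by simp
  with le show ?thesis
    by (intro that[of "Suc k"]) auto
qed

text \<open>Supplies the hypothesis \<open>x \<ge> 1\<close> of
  \<open>exists_power_within_factor\<close>: costs are integers, and positivity passes from the
  one-letter edge to all longer edges.\<close>

lemma edge_cost_ge_1:
  assumes "monotone_costs C T" "1 \<le> i" "i < j" "j \<le> length T + 1"
  shows "1 \<le> edge_cost C T (i, j)"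
proof -
  have "edge_cost C T (i, Suc i) \<le> edge_cost C T (i, j)"
    using assms(3)[THEN Suc_leI] assms(4)
  proof (induction j rule: dec_induct)
    case (step m)
    then have "edge_cost C T (i, m) \<le> edge_cost C T (i, Suc m)"
      using assms(1,2) unfolding monotone_costs_def by auto
    with step show ?case
      by simp
  qed simp
  moreover have "0 < edge_cost C T (i, i + 1)"
    using assms unfolding monotone_costs_def by auto
  ultimately show ?thesis
    by simp
qed

text \<open>Both substrings end at \<open>j - 1\<close>, so the one starting later is a suffix of
  the other.\<close>

lemma edge_cost_antimono_left:
  assumes "monotone_costs C T" "1 \<le> i" "i \<le> s" "s < j" "j \<le> length T + 1"
  shows "edge_cost C T (s, j) \<le> edge_cost C T (i, j)"
proof -
  have "drop (s - 1) (take (j - 1) T) = drop (s - i) (drop (i - 1) (take (j - 1) T))"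
    using assms by (simp add: add.commute)
  then have "sublist (substring T s (j - 1)) (substring T i (j - 1))"
    unfolding substring_def by (metis sublist_drop)
  moreover have "sublist (substring T i (j - 1)) T"
    unfolding substring_def by (meson sublist_drop sublist_take sublist_order.order_trans)
  moreover have "substring T s (j - 1) \<noteq> []"
    using assms unfolding substring_def by auto
  ultimately show ?thesis
    using assms(1) unfolding monotone_costs_def edge_cost_def by simp
qed

lemma exists_longer_pruned_arc:
  assumes "\<epsilon> > 0" "monotone_costs C T" "1 \<le> i" "i \<le> s" "s < j" "j \<le> length T + 1"
  obtains j' where "(s, j') \<in> parcs (pruned_dag C \<epsilon> T)" "j \<le> j'" "j' \<le> length T + 1"
    "real (edge_cost C T (s, j')) \<le> (1 + \<epsilon>) * real (edge_cost C T (i, j))"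
proof -
  let ?c = "\<lambda>j. real (edge_cost C T (s, j))"
  have "1 \<le> ?c j"
    using edge_cost_ge_1[of C T s j] assms by simp
  then obtain k where k: "k \<ge> 1" "?c j \<le> (1 + \<epsilon>) ^ k" "(1 + \<epsilon>) ^ k \<le> (1 + \<epsilon>) * ?c j"
    using exists_power_within_factor[of "1 + \<epsilon>" "?c j"] assms(1) by auto
  define P where "P = (\<lambda>m. m \<le> length T + 1 \<and> ?c m \<le> (1 + \<epsilon>) ^ k)"
  have bound: "\<And>m. P m \<Longrightarrow> m \<le> length T + 1"
    by (simp add: P_def)
  have Pj: "P j"
    using k assms by (simp add: P_def)
  \<comment> \<open>The farthest endpoint whose cost from \<open>s\<close> still fits under the
    rounded power; it exists because \<open>P\<close> holds at \<open>j\<close> and is bounded by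
    \<open>length T + 1\<close>.\<close>
  define j' where "j' = (GREATEST m. P m)"
  have j': "P j'" and jj': "j \<le> j'"
    unfolding j'_def using GreatestI_nat[of P, OF Pj bound] Greatest_le_nat[of P, OF Pj bound]
    by auto
  \<comment> \<open>Maximality leaves two options, which are the two pruning alternatives:
    \<open>j'\<close> is the last vertex, or the next longer edge exceeds the power.\<close>
  have "\<not> P (j' + 1)"
    using Greatest_le_nat[of P "j' + 1", OF _ bound] unfolding j'_def by fastforce
  then have "j' \<le> length T \<Longrightarrow> (1 + \<epsilon>) ^ k < ?c (j' + 1)"
    by (auto simp: P_def)
  moreover have "j' \<le> length T + 1" "?c j' \<le> (1 + \<epsilon>) ^ k"
    using j' by (auto simp: P_def)
  ultimately have arc: "(s, j') \<in> parcs (pruned_dag C \<epsilon> T)"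
    using assms jj' k(1) by (fastforce simp: pruned_dag_def partition_dag_def)
  have "?c j' \<le> (1 + \<epsilon>) * ?c j"
    using k(3) \<open>?c j' \<le> (1 + \<epsilon>) ^ k\<close> by linarith
  also have "\<dots> \<le> (1 + \<epsilon>) * real (edge_cost C T (i, j))"
    using edge_cost_antimono_left[of C T i s j] assms by (intro mult_left_mono) auto
  finally show ?thesis
    using that arc jj' \<open>j' \<le> length T + 1\<close> by blast
qed

text \<open>The start \<open>s\<close> is separate from \<open>i\<close> because the pruned walk may
  run ahead; \<open>i \<le> s\<close> is the invariant of the induction along
  \<open>q\<close>.\<close>

lemma exists_pruned_awalk:
  assumes "\<epsilon> > 0" "monotone_costs C T"
    and "pre_digraph.awalk (with_proj (partition_dag T)) i q (length T + 1)"
    and "i \<le> s" "s \<le> length T + 1"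
  shows "\<exists>p. pre_digraph.awalk (with_proj (pruned_dag C \<epsilon> T)) s p (length T + 1) \<and>
    wf_digraph.awalk_cost (\<lambda>e. real (edge_cost C T e)) p
      \<le> (1 + \<epsilon>) * wf_digraph.awalk_cost (\<lambda>e. real (edge_cost C T e)) q"
  using assms(3-5)
proof (induction q arbitrary: i s)
  interpret G: wf_digraph "with_proj (partition_dag T)"
    by (rule wf_partition_dag)
  interpret P: wf_digraph "with_proj (pruned_dag C \<epsilon> T)"
    by (rule wf_pruned_dag)
  let ?c = "\<lambda>e. real (edge_cost C T e)"
  {
    case Nil
    then have "s = length T + 1"
      by (simp add: G.awalk_Nil_iff)
    then have "P.awalk s [] (length T + 1)"
      unfolding P.awalk_Nil_iff by (simp add: pruned_dag_def partition_dag_def)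
    then show ?case
      by (intro exI[of _ "[]"]) simp
  next
    case (Cons e q)
    obtain j where e: "e = (i, j)" "1 \<le> i" "i < j" "j \<le> length T + 1"
      and q: "G.awalk j q (length T + 1)"
    proof -
      have "e \<in> parcs (partition_dag T)" "fst e = i" "G.awalk (snd e) q (length T + 1)"
        using Cons.prems(1) unfolding G.awalk_Cons_iff by auto
      then show ?thesis
        by (intro that[of "snd e"]) (auto simp: partition_dag_def)
    qed
    show ?case
    proof (cases "j \<le> s")
      \<comment> \<open>The pruned walk is already at or beyond \<open>j\<close>: it stays at
        \<open>s\<close>, and the nonnegative cost of \<open>e\<close> is simply given away.\<close>
      case True
      obtain p where p: "P.awalk s p (length T + 1)"
        "G.awalk_cost ?c p \<le> (1 + \<epsilon>) * G.awalk_cost ?c q"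
        using Cons.IH[OF q True Cons.prems(3)] by blast
      have "(1 + \<epsilon>) * G.awalk_cost ?c q \<le> (1 + \<epsilon>) * G.awalk_cost ?c (e # q)"
        using assms(1) by (intro mult_left_mono) auto
      with p show ?thesis
        by (meson order_trans)
    next
      \<comment> \<open>Here \<open>e\<close> pays for one pruned arc, whose endpoint
        \<open>j'\<close> restores the invariant \<open>j \<le> j'\<close>.\<close>
      case False
      then have "s < j"
        by simp
      then obtain j' where j': "(s, j') \<in> parcs (pruned_dag C \<epsilon> T)" "j \<le> j'"
        "j' \<le> length T + 1" "?c (s, j') \<le> (1 + \<epsilon>) * ?c e"
        using exists_longer_pruned_arc[OF assms(1,2) e(2) Cons.prems(2) _ e(4)] e(1) by blast
      obtain p where p: "P.awalk j' p (length T + 1)"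
        "G.awalk_cost ?c p \<le> (1 + \<epsilon>) * G.awalk_cost ?c q"
        using Cons.IH[OF q j'(2,3)] by blast
      have "P.awalk s ((s, j') # p) (length T + 1)"
        using p j' by (simp add: P.awalk_Cons_iff)
      moreover have "G.awalk_cost ?c ((s, j') # p) \<le> (1 + \<epsilon>) * G.awalk_cost ?c (e # q)"
        using p(2) j'(4) by (simp add: distrib_left)
      ultimately show ?thesis
        by blast
    qed
  }
qed

lemma fin_pruned_dag: "fin_digraph (with_proj (pruned_dag C \<epsilon> T))"
proof -
  have "parcs (pruned_dag C \<epsilon> T) \<subseteq> {1..length T + 1} \<times> {1..length T + 1}"
    by (auto simp: pruned_dag_def partition_dag_def)
  then have "finite (parcs (pruned_dag C \<epsilon> T))"
    by (rule finite_subset) simp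
  then show ?thesis
    by (intro fin_digraph.intro wf_pruned_dag fin_digraph_axioms.intro)
      (simp_all add: pruned_dag_def partition_dag_def)
qed

lemma (in fin_digraph) exists_shortest_path:
  assumes "u \<rightarrow>\<^sup>* v" "\<And>e. e \<in> arcs G \<Longrightarrow> 0 \<le> w e"
  shows "\<exists>p. shortest_path G w u p v"
proof -
  obtain p where "apath u p v" "\<mu> w u v = awalk_cost w p"
    using min_cost_awalk[of u v w] assms by blast
  then show ?thesis
    unfolding shortest_path_def by (metis awalkI_apath ereal_less_eq(3) min_cost_le_walk_cost)
qed

text \<open>\<open>shortest_path\<close> compares only with paths, while the greedy construction
  yields a walk. A path attaining the minimum over walks bridges the two.\<close>

lemma (in fin_digraph) shortest_path_cost_le_awalk_cost:
  assumes "shortest_path G w u p v" "awalk u q v" "\<And>e. e \<in> arcs G \<Longrightarrow> 0 \<le> w e"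
  shows "awalk_cost w p \<le> awalk_cost w q"
proof -
  have "u \<rightarrow>\<^sup>* v"
    using assms(2) by (auto simp: reachable_awalk)
  then obtain r where "apath u r v" "\<mu> w u v = awalk_cost w r"
    using min_cost_awalk[of u v w] assms(3) by blast
  then have "awalk_cost w r \<le> awalk_cost w q"
    using min_cost_le_walk_cost[OF assms(2)] by (metis ereal_less_eq(3))
  moreover have "awalk_cost w p \<le> awalk_cost w r"
    using assms(1) \<open>apath u r v\<close> by (simp add: shortest_path_def)
  ultimately show ?thesis
    by simp
qed

theorem theorem1:
  fixes C :: "'a compressor" and T :: "'a list" and \<epsilon> :: real
  assumes "\<epsilon> > 0"
    and "prefix_free C"
    and "monotone_costs C T"
  defines "c \<equiv> (\<lambda>e. real (edge_cost C T e))"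
  defines "n \<equiv> length T"
  shows "(\<exists>p. shortest_path (with_proj (pruned_dag C \<epsilon> T)) c 1 p (n + 1)) \<and>
    (\<forall>p. shortest_path (with_proj (pruned_dag C \<epsilon> T)) c 1 p (n + 1) \<longrightarrow>
       ereal (wf_digraph.awalk_cost c p)
         \<le> ereal (1 + \<epsilon>) * wf_digraph.\<mu> (with_proj (partition_dag T)) c 1 (n + 1))"
proof -
  interpret G: wf_digraph "with_proj (partition_dag T)"
    by (rule wf_partition_dag)
  interpret P: fin_digraph "with_proj (pruned_dag C \<epsilon> T)"
    by (rule fin_pruned_dag)
  have nonneg: "0 \<le> c e" for e
    by (simp add: c_def)
  have approx: "\<exists>p. P.awalk 1 p (n + 1) \<and> G.awalk_cost c p \<le> (1 + \<epsilon>) * G.awalk_cost c q"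
    if "G.awalk 1 q (n + 1)" for q
    using exists_pruned_awalk[of \<epsilon> C T 1 q 1] that assms by simp
  \<comment> \<open>The whole string as a single part gives a walk; for the empty string source and
    target coincide. Its pruned counterpart makes the target reachable.\<close>
  have "\<exists>q. G.awalk 1 q (n + 1)"
  proof (cases "n = 0")
    case True
    then have "G.awalk 1 [] (n + 1)"
      unfolding G.awalk_Nil_iff by (simp add: partition_dag_def)
    then show ?thesis ..
  next
    case False
    then have "G.awalk 1 [(1, n + 1)] (n + 1)"
      unfolding G.awalk_simps by (simp add: partition_dag_def n_def)
    then show ?thesis ..
  qed
  with approx obtain p where "P.awalk 1 p (n + 1)"
    by blast
  then have "\<exists>p. shortest_path (with_proj (pruned_dag C \<epsilon> T)) c 1 p (n + 1)"
    using nonneg by (intro P.exists_shortest_path) (auto simp: P.reachable_awalk)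
  moreover have "ereal (G.awalk_cost c p) \<le> ereal (1 + \<epsilon>) * G.\<mu> c 1 (n + 1)"
    if p: "shortest_path (with_proj (pruned_dag C \<epsilon> T)) c 1 p (n + 1)" for p
  proof -
    \<comment> \<open>Dividing by \<open>1 + \<epsilon>\<close> turns the claim into a lower bound
      on an infimum, which can be checked for each walk \<open>q\<close> separately.\<close>
    have "ereal (G.awalk_cost c p / (1 + \<epsilon>)) \<le> G.\<mu> c 1 (n + 1)"
      unfolding G.\<mu>_def
    proof (rule INF_greatest)
      fix q assume "q \<in> {q. G.awalk 1 q (n + 1)}"
      then obtain r where "P.awalk 1 r (n + 1)" "G.awalk_cost c r \<le> (1 + \<epsilon>) * G.awalk_cost c q"
        using approx by blast
      then have "G.awalk_cost c p \<le> (1 + \<epsilon>) * G.awalk_cost c q"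
        using P.shortest_path_cost_le_awalk_cost[OF p _ nonneg] by fastforce
      then show "ereal (G.awalk_cost c p / (1 + \<epsilon>)) \<le> ereal (G.awalk_cost c q)"
        using assms(1) by (simp add: field_simps)
    qed
    then have "ereal (1 + \<epsilon>) * ereal (G.awalk_cost c p / (1 + \<epsilon>))
        \<le> ereal (1 + \<epsilon>) * G.\<mu> c 1 (n + 1)"
      using assms(1) by (intro ereal_mult_left_mono) auto
    then show ?thesis
      using assms(1) by simp
  qed
  ultimately show ?thesis
    by blast
qed

end
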